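(* Let $\ell_1,\ell_2,\ell_3\in\mathbb{Z}_{\ge0}$ and let $\lambda$ be the dominant weight of $\mathrm{SL}_4$ with fundamental-weight coordinates $(\ell_1,\ell_2,\ell_3)$. If $\ell_1+\ell_3\equiv1\pmod2$, then, for every $q\geq0$ and $\varepsilon\in\{0,1\}$, $$H^q(\mathrm{SL}_4(\mathbb{Z}),\mathcal{M}_\lambda)=0,\qquad H^q\bigl(\mathrm{GL}_4(\mathbb{Z}),\widetilde{\mathcal{M}}_\lambda\otimes\det{}^{\varepsilon}\bigr)=0.$$
   Context: $\mathcal{M}_\lambda$ is the irreducible finite-dimensional rational algebraic representation of $\mathrm{SL}_4$ over $\mathbb{Q}$ with highest weight $\lambda=\ell_1\omega_1+\ell_2\omega_2+\ell_3\omega_3$ (diagonal torus, upper-triangular Borel, $\omega_i=\epsilon_1+\dots+\epsilon_i$), viewed as an $\mathrm{SL}_4(\mathbb{Z})$-module. $\widetilde{\mathcal{M}}_\lambda$ is its polynomial extension to $\mathrm{GL}_4$: the irreducible representation of $\mathrm{GL}_4$ with highest weight $(\ell_1+\ell_2+\ell_3,\ell_2+\ell_3,\ell_3,0)$, viewed as a $\mathrm{GL}_4(\mathbb{Z})$-module. *)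

theory Defs
  imports "HOL-Analysis.Analysis" "HOL-Algebra.Elementary_Groups"
begin

section \<open>Matrix groups\<close>

definition GL :: "('a::comm_ring_1 ^ 'n ^ 'n) monoid"
  where "GL = \<lparr>carrier = {A. invertible A}, mult = (**), one = mat 1\<rparr>"

definition SL :: "('a::comm_ring_1 ^ 'n ^ 'n) monoid"
  where "SL = \<lparr>carrier = {A. det A = 1}, mult = (**), one = mat 1\<rparr>"


section \<open>Algebraic representations over the rationals\<close>

text \<open>
  The coordinate ring of \<open>GL\<^sub>n\<close> over \<open>\<rat>\<close>, seen as a ring of functions on rational points.
  Since \<open>\<rat>\<close> is infinite, the rational points of \<open>GL\<^sub>n\<close> and of \<open>SL\<^sub>n\<close> are Zariski dense, so algebraic
  representations over \<open>\<rat>\<close>, their subrepresentations and their weights are determined on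
  rational points. On \<open>SL\<^sub>n\<close> the generator \<open>1/det\<close> is the constant 1, so the restrictions of these
  functions to \<open>SL\<^sub>n\<close> are exactly the polynomials in the matrix entries.
\<close>

inductive_set regular_functions :: "(rat ^ 'n ^ 'n \<Rightarrow> rat) set" where
  const: "(\<lambda>_. c) \<in> regular_functions"
| entry: "(\<lambda>A. A $ i $ j) \<in> regular_functions"
| inverse_det: "(\<lambda>A. inverse (det A)) \<in> regular_functions"
| add: "f \<in> regular_functions \<Longrightarrow> h \<in> regular_functions \<Longrightarrow> (\<lambda>A. f A + h A) \<in> regular_functions"
| mult: "f \<in> regular_functions \<Longrightarrow> h \<in> regular_functions \<Longrightarrow> (\<lambda>A. f A * h A) \<in> regular_functions"

text \<open>
  The representation space is a whole type \<^typ>\<open>'v\<close> with scalar multiplication \<open>smul\<close>; the group \<open>G\<close>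
  is meant to be \<^const>\<open>GL\<close> or \<^const>\<open>SL\<close>, and only the values of \<open>\<rho>\<close> on \<open>carrier G\<close> matter.
  The last clause says that every matrix coefficient is a regular function.
\<close>

definition algebraic_representation ::
    "(rat ^ 'n ^ 'n) monoid \<Rightarrow> (rat \<Rightarrow> 'v::ab_group_add \<Rightarrow> 'v) \<Rightarrow> (rat ^ 'n ^ 'n \<Rightarrow> 'v \<Rightarrow> 'v) \<Rightarrow> bool"
  where "algebraic_representation G smul \<rho> \<longleftrightarrow>
    (\<exists>B. finite_dimensional_vector_space smul B) \<and>
    (\<forall>g\<in>carrier G. Vector_Spaces.linear smul smul (\<rho> g)) \<and>
    \<rho> \<one>\<^bsub>G\<^esub> = id \<and>
    (\<forall>g\<in>carrier G. \<forall>h\<in>carrier G. \<rho> (g \<otimes>\<^bsub>G\<^esub> h) = \<rho> g \<circ> \<rho> h) \<and>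
    (\<forall>v \<phi>. Vector_Spaces.linear smul (*) \<phi> \<longrightarrow>
      (\<exists>f\<in>regular_functions. \<forall>g\<in>carrier G. \<phi> (\<rho> g v) = f g))"

definition irreducible_representation ::
    "(rat ^ 'n ^ 'n) monoid \<Rightarrow> (rat \<Rightarrow> 'v::ab_group_add \<Rightarrow> 'v) \<Rightarrow> (rat ^ 'n ^ 'n \<Rightarrow> 'v \<Rightarrow> 'v) \<Rightarrow> bool"
  where "irreducible_representation G smul \<rho> \<longleftrightarrow>
    (\<exists>v::'v. v \<noteq> 0) \<and>
    (\<forall>W. module.subspace smul W \<and> (\<forall>g\<in>carrier G. \<rho> g ` W \<subseteq> W) \<longrightarrow> W = {0} \<or> W = UNIV)"

text \<open>
  A weight \<open>\<mu> = (\<mu>\<^sub>i)\<close> is the character sending a diagonal matrix with entries \<open>t\<^sub>i\<close> to the product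
  of the \<open>t\<^sub>i\<close> to the power \<open>\<mu>\<^sub>i\<close>. The representation has highest weight \<open>\<mu>\<close> with respect to the
  upper triangular Borel subgroup if it has a nonzero vector of weight \<open>\<mu>\<close> fixed by the
  upper unitriangular matrices.
\<close>

definition has_highest_weight ::
    "(rat ^ ('n::{finite,linorder}) ^ ('n::{finite,linorder})) monoid \<Rightarrow> (rat \<Rightarrow> 'v::ab_group_add \<Rightarrow> 'v) \<Rightarrow>
      (rat ^ ('n::{finite,linorder}) ^ ('n::{finite,linorder}) \<Rightarrow> 'v \<Rightarrow> 'v) \<Rightarrow> ('n \<Rightarrow> int) \<Rightarrow> bool"
  where "has_highest_weight G smul \<rho> \<mu> \<longleftrightarrow>
    (\<exists>v. v \<noteq> 0 \<and>
      (\<forall>u\<in>carrier G. (\<forall>i. u $ i $ i = 1) \<and> (\<forall>i j. j < i \<longrightarrow> u $ i $ j = 0) \<longrightarrow> \<rho> u v = v) \<and>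
      (\<forall>t\<in>carrier G. (\<forall>i j. i \<noteq> j \<longrightarrow> t $ i $ j = 0) \<longrightarrow>
        \<rho> t v = smul (\<Prod>i\<in>UNIV. (t $ i $ i) powi \<mu> i) v))"

definition highest_weight_module ::
    "(rat ^ ('n::{finite,linorder}) ^ ('n::{finite,linorder})) monoid \<Rightarrow> ('n \<Rightarrow> int) \<Rightarrow>
      (rat \<Rightarrow> 'v::ab_group_add \<Rightarrow> 'v) \<Rightarrow>
      (rat ^ ('n::{finite,linorder}) ^ ('n::{finite,linorder}) \<Rightarrow> 'v \<Rightarrow> 'v) \<Rightarrow> bool"
  where "highest_weight_module G \<mu> smul \<rho> \<longleftrightarrow>
    algebraic_representation G smul \<rho> \<and>
    irreducible_representation G smul \<rho> \<and>
    has_highest_weight G smul \<rho> \<mu>"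

text \<open>
  The elements of the index type \<^typ>\<open>4\<close> are \<open>0 < 1 < 2 < 3\<close> (the numeral 4 denotes 0 there), so
  rows and columns are numbered from 0, and \<open>\<omega>\<^sub>k = \<epsilon>\<^sub>1 + \<dots> + \<epsilon>\<^sub>k\<close> is the indicator of \<open>{j. j < k}\<close>.
\<close>

definition fundamental_weight :: "4 \<Rightarrow> 4 \<Rightarrow> int"
  where "fundamental_weight k j = (if j < k then 1 else 0)"

definition SL4_weight :: "nat \<Rightarrow> nat \<Rightarrow> nat \<Rightarrow> 4 \<Rightarrow> int"
  where "SL4_weight l1 l2 l3 j =
    int l1 * fundamental_weight 1 j + int l2 * fundamental_weight 2 j + int l3 * fundamental_weight 3 j"

definition GL4_weight :: "nat \<Rightarrow> nat \<Rightarrow> nat \<Rightarrow> 4 \<Rightarrow> int"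
  where "GL4_weight l1 l2 l3 =
    (\<lambda>_. 0)(0 := int (l1 + l2 + l3), 1 := int (l2 + l3), 2 := int l3, 3 := 0)"

text \<open>
  The tensor product with the one-dimensional representation \<open>det\<^sup>k\<close>, on the same underlying space.
\<close>

definition det_twist ::
    "nat \<Rightarrow> (rat \<Rightarrow> 'v \<Rightarrow> 'v) \<Rightarrow> (rat ^ 'n ^ 'n \<Rightarrow> 'v \<Rightarrow> 'v) \<Rightarrow> rat ^ 'n ^ 'n \<Rightarrow> 'v \<Rightarrow> 'v"
  where "det_twist k smul \<rho> g v = smul (det g ^ k) (\<rho> g v)"

definition restrict_to_int :: "(rat ^ 'n ^ 'n \<Rightarrow> 'v \<Rightarrow> 'v) \<Rightarrow> int ^ 'n ^ 'n \<Rightarrow> 'v \<Rightarrow> 'v"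
  where "restrict_to_int \<rho> A = \<rho> (map_matrix of_int A)"


section \<open>Group cohomology\<close>

text \<open>
  Cohomology of a group \<open>G\<close> acting on an abelian group by \<open>act\<close>, computed by the homogeneous
  cochains, that is, from the standard resolution of the integers: \<open>q\<close>-cochains are the
  \<open>G\<close>-equivariant functions on \<open>(q+1)\<close>-tuples of group elements. Tuples are lists, and cochains
  are normalised to be 0 outside the relevant lists, so that equality is equality of functions.
\<close>

definition tuples :: "('g, 'b) monoid_scheme \<Rightarrow> nat \<Rightarrow> 'g list set"
  where "tuples G n = {xs. length xs = n \<and> set xs \<subseteq> carrier G}"

definition cochains ::
    "('g, 'b) monoid_scheme \<Rightarrow> ('g \<Rightarrow> 'v \<Rightarrow> 'v) \<Rightarrow> nat \<Rightarrow> ('g list \<Rightarrow> 'v::ab_group_add) set"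
  where "cochains G act q =
    {f. (\<forall>xs. xs \<notin> tuples G (q + 1) \<longrightarrow> f xs = 0) \<and>
        (\<forall>g\<in>carrier G. \<forall>xs\<in>tuples G (q + 1). f (map (\<lambda>x. g \<otimes>\<^bsub>G\<^esub> x) xs) = act g (f xs))}"

definition coboundary_map ::
    "('g, 'b) monoid_scheme \<Rightarrow> nat \<Rightarrow> ('g list \<Rightarrow> 'v) \<Rightarrow> 'g list \<Rightarrow> 'v::ab_group_add"
  where "coboundary_map G q f xs =
    (if xs \<in> tuples G (q + 2)
     then \<Sum>i = 0..q + 1. let y = f (take i xs @ drop (Suc i) xs) in if even i then y else - y
     else 0)"

definition cocycles ::
    "('g, 'b) monoid_scheme \<Rightarrow> ('g \<Rightarrow> 'v \<Rightarrow> 'v) \<Rightarrow> nat \<Rightarrow> ('g list \<Rightarrow> 'v::ab_group_add) set"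
  where "cocycles G act q = {f \<in> cochains G act q. coboundary_map G q f = (\<lambda>_. 0)}"

definition coboundaries ::
    "('g, 'b) monoid_scheme \<Rightarrow> ('g \<Rightarrow> 'v \<Rightarrow> 'v) \<Rightarrow> nat \<Rightarrow> ('g list \<Rightarrow> 'v::ab_group_add) set"
  where "coboundaries G act q =
    (case q of 0 \<Rightarrow> {\<lambda>_. 0} | Suc p \<Rightarrow> coboundary_map G p ` cochains G act p)"

definition cocycle_group ::
    "('g, 'b) monoid_scheme \<Rightarrow> ('g \<Rightarrow> 'v \<Rightarrow> 'v) \<Rightarrow> nat \<Rightarrow> ('g list \<Rightarrow> 'v::ab_group_add) monoid"
  where "cocycle_group G act q =
    \<lparr>carrier = cocycles G act q, mult = (\<lambda>f h xs. f xs + h xs), one = (\<lambda>_. 0)\<rparr>"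

definition group_cohomology ::
    "('g, 'b) monoid_scheme \<Rightarrow> ('g \<Rightarrow> 'v \<Rightarrow> 'v) \<Rightarrow> nat \<Rightarrow> ('g list \<Rightarrow> 'v::ab_group_add) set monoid"
  where "group_cohomology G act q = cocycle_group G act q Mod coboundaries G act q"

end

theory Submission
  imports Defs
begin

text \<open>
  The matrix \<open>-I\<close> is a central element of \<open>SL\<^sub>4(\<int>)\<close> and of \<open>GL\<^sub>4(\<int>)\<close>. By Schur's argument it acts
  on an irreducible representation by the scalar through which it acts on the highest weight
  vector (\<open>scalar_matrix_acts_by_highest_weight\<close>), and for both weights considered this scalar is
  \<open>(-1)\<close> to the power \<open>l1 + 2 * l2 + 3 * l3\<close>, that is \<open>-1\<close> when \<open>l1 + l3\<close> is odd. Twisting by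
  the determinant changes nothing, as \<open>-I\<close> has determinant 1 in even dimension.

  On the other hand a central element \<open>z\<close> of any group acts trivially on cohomology. In terms of
  homogeneous cochains, translating all arguments by \<open>z\<close> is a map of complexes that is homotopic
  to the identity by the usual prism operator (\<open>prism_homotopy\<close>), and centrality of \<open>z\<close> makes this
  homotopy equivariant. If \<open>z\<close> acts on the coefficients by a scalar \<open>c\<close>, equivariance says that
  the translation map is multiplication by \<open>c\<close>, so \<open>c - 1\<close> annihilates the cohomology. Over a field
  and with \<open>c \<noteq> 1\<close> the cohomology vanishes (\<open>cohomology_vanishes_if_central_scalar\<close>). Here
  \<open>c - 1 = -2\<close>, which is invertible in \<open>\<rat>\<close>.
\<close>

section \<open>The prism homotopy for functions on lists\<close>

text \<open>
  The homogeneous coboundary in a recursive form, which keeps the signs implicit and lets the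
  identities below be proved by induction on the list. The empty list is the simplex of dimension
  \<open>-1\<close>, so this is the coboundary of the augmented complex.
\<close>

fun alternating_faces :: "('g list \<Rightarrow> 'v::ab_group_add) \<Rightarrow> 'g list \<Rightarrow> 'v" where
  "alternating_faces f [] = 0"
| "alternating_faces f (x # xs) = f xs - alternating_faces (\<lambda>ys. f (x # ys)) xs"

text \<open>
  The alternating sum of \<open>f\<close> over the lists \<open>[x\<^sub>0, \<dots>, x\<^sub>i, m x\<^sub>i, \<dots>, m x\<^sub>n]\<close>, which triangulate the
  prism between \<open>xs\<close> and its translate.
\<close>

fun prism :: "('g \<Rightarrow> 'g) \<Rightarrow> ('g list \<Rightarrow> 'v::ab_group_add) \<Rightarrow> 'g list \<Rightarrow> 'v" where
  "prism m f [] = 0"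
| "prism m f (x # xs) = f (x # m x # map m xs) - prism m (\<lambda>ys. f (x # ys)) xs"

lemma alternating_faces_eq_sum:
  "alternating_faces f xs =
    (\<Sum>i<length xs. if even i then f (take i xs @ drop (Suc i) xs) else - f (take i xs @ drop (Suc i) xs))"
proof (induction xs arbitrary: f)
  case (Cons x xs)
  show ?case
    unfolding alternating_faces.simps Cons.IH length_Cons sum.lessThan_Suc_shift
      diff_conv_add_uminus sum_negf[symmetric]
    by (intro arg_cong2[where f = "(+)"] sum.cong) auto
qed simp

lemma alternating_faces_zero: "alternating_faces (\<lambda>_. 0) xs = 0"
  by (induction xs) auto

lemma alternating_faces_add:
  "alternating_faces (\<lambda>ys. f ys + h ys) xs = alternating_faces f xs + alternating_faces h xs"
  by (induction xs arbitrary: f h) (auto simp: algebra_simps)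

lemma alternating_faces_uminus:
  "alternating_faces (\<lambda>ys. - f ys) xs = - alternating_faces f xs"
  by (induction xs arbitrary: f) (auto simp: algebra_simps)

lemma alternating_faces_diff:
  "alternating_faces (\<lambda>ys. f ys - h ys) xs = alternating_faces f xs - alternating_faces h xs"
  by (induction xs arbitrary: f h) (auto simp: algebra_simps)

lemma prism_diff: "prism m (\<lambda>ys. f ys - h ys) xs = prism m f xs - prism m h xs"
  by (induction xs arbitrary: f h) (auto simp: algebra_simps)

lemma alternating_faces_map:
  "alternating_faces (\<lambda>ys. f (map m ys)) xs = alternating_faces f (map m xs)"
proof (induction xs arbitrary: f)
  case (Cons x xs)
  show ?case
    using Cons.IH[of "\<lambda>ys. f (m x # ys)"] by simp
qed simp

lemma alternating_faces_twice:
  "alternating_faces (alternating_faces f) xs = 0"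
  by (induction xs arbitrary: f) (auto simp: alternating_faces_diff)

text \<open>
  Translation by an arbitrary map \<open>m\<close> is homotopic to the identity. Both composites unfold to terms
  for the tail of the list, where all terms but the two ends of the prism cancel.
\<close>

lemma prism_homotopy:
  "alternating_faces (prism m f) xs + prism m (alternating_faces f) xs = f (map m xs) - f xs"
proof (induction xs arbitrary: f)
  case (Cons x xs)
  show ?case
    using Cons.IH[of "\<lambda>ys. f (x # ys)"]
      alternating_faces_map[of "\<lambda>ys. f (x # m x # ys)" m xs]
    by (simp add: alternating_faces_diff prism_diff algebra_simps)
qed simp

text \<open>
  The values of a cochain are only controlled on tuples from the carrier. The next two lemmas say
  that both operators respect a relation \<open>h (map t ys) = a (f ys)\<close> that is known there only.
  They serve for equivariance, with \<open>t\<close> a translation and \<open>a\<close> the action, for compatibility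
  with scalars, with \<open>t\<close> the identity, and for replacing a function by one with the same values.
\<close>

lemma alternating_faces_natural:
  assumes "Modules.additive a"
    and "\<And>ys. set ys \<subseteq> S \<Longrightarrow> Suc (length ys) = length xs \<Longrightarrow> h (map t ys) = a (f ys)"
    and "set xs \<subseteq> S"
  shows "alternating_faces h (map t xs) = a (alternating_faces f xs)"
  using assms(2,3)
proof (induction xs arbitrary: f h)
  case Nil
  then show ?case using assms(1) by (simp add: Modules.additive.zero)
next
  case (Cons x xs)
  have "alternating_faces (\<lambda>ys. h (t x # ys)) (map t xs) = a (alternating_faces (\<lambda>ys. f (x # ys)) xs)"
  proof (rule Cons.IH)
    fix ys assume "set ys \<subseteq> S" "Suc (length ys) = length xs"
    then show "h (t x # map t ys) = a (f (x # ys))"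
      using Cons.prems(1)[of "x # ys"] Cons.prems(2) by simp
  qed (use Cons.prems(2) in auto)
  moreover have "h (map t xs) = a (f xs)"
    using Cons.prems by simp
  ultimately show ?case
    using assms(1) by (simp add: Modules.additive.diff)
qed

lemma prism_natural:
  assumes "Modules.additive a"
    and "\<And>ys. set ys \<subseteq> S \<Longrightarrow> length ys = Suc (length xs) \<Longrightarrow> h (map t ys) = a (f ys)"
    and "set xs \<subseteq> S"
    and "\<And>x. x \<in> S \<Longrightarrow> m x \<in> S"
    and "\<And>x. x \<in> S \<Longrightarrow> m (t x) = t (m x)"
  shows "prism m h (map t xs) = a (prism m f xs)"
  using assms(2,3)
proof (induction xs arbitrary: f h)
  case Nil
  then show ?case using assms(1) by (simp add: Modules.additive.zero)
next
  case (Cons x xs)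
  have "prism m (\<lambda>ys. h (t x # ys)) (map t xs) = a (prism m (\<lambda>ys. f (x # ys)) xs)"
  proof (rule Cons.IH)
    fix ys assume "set ys \<subseteq> S" "length ys = Suc (length xs)"
    then show "h (t x # map t ys) = a (f (x # ys))"
      using Cons.prems(1)[of "x # ys"] Cons.prems(2) by simp
  qed (use Cons.prems(2) in auto)
  moreover have "h (t x # m (t x) # map m (map t xs)) = a (f (x # m x # map m xs))"
  proof -
    have "map m (map t xs) = map t (map m xs)"
      using Cons.prems(2) assms(5) by auto
    moreover have "set (x # m x # map m xs) \<subseteq> S"
      using Cons.prems(2) assms(4) by auto
    ultimately show ?thesis
      using Cons.prems(1)[of "x # m x # map m xs"] Cons.prems(2) assms(5) by (simp del: map_map)
  qed
  ultimately show ?case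
    using assms(1) by (simp add: Modules.additive.diff)
qed

lemma additive_id: "Modules.additive (\<lambda>v. v)"
  by (simp add: Modules.additive_def)

section \<open>Central elements acting by a scalar kill cohomology\<close>

lemma coboundary_map_eq_alternating_faces:
  "coboundary_map G q f xs = (if xs \<in> tuples G (q + 2) then alternating_faces f xs else 0)"
proof -
  have "{0..q + 1} = {..<length xs}" if "xs \<in> tuples G (q + 2)"
    using that by (auto simp: tuples_def)
  then show ?thesis
    unfolding coboundary_map_def alternating_faces_eq_sum by (simp add: Let_def)
qed

lemma (in monoid) map_mult_tuples:
  assumes "g \<in> carrier G" "xs \<in> tuples G n"
  shows "map (\<lambda>x. g \<otimes> x) xs \<in> tuples G n"
  using assms by (auto simp: tuples_def)

lemma (in monoid) coboundary_map_in_cocycles: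
  assumes act: "\<And>g. g \<in> carrier G \<Longrightarrow> Modules.additive (act g)"
    and f: "f \<in> cochains G act q"
  shows "coboundary_map G q f \<in> cocycles G act (Suc q)"
proof -
  let ?d = "coboundary_map G q f"
  have "?d (map (\<lambda>x. g \<otimes> x) xs) = act g (?d xs)" if "g \<in> carrier G" "xs \<in> tuples G (q + 2)" for g xs
  proof -
    have "alternating_faces f (map (\<lambda>x. g \<otimes> x) xs) = act g (alternating_faces f xs)"
      using f that
      by (intro alternating_faces_natural[where S = "carrier G"] act)
        (auto simp: cochains_def tuples_def)
    then show ?thesis
      using map_mult_tuples[OF that] that(2) by (simp add: coboundary_map_eq_alternating_faces)
  qed
  moreover have "coboundary_map G (Suc q) ?d xs = 0" for xs
  proof (cases "xs \<in> tuples G (q + 3)")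
    case True
    have "alternating_faces ?d (map (\<lambda>x. x) xs) = alternating_faces (alternating_faces f) xs"
      using True
      by (intro alternating_faces_natural[where S = "carrier G" and a = "\<lambda>v. v"] additive_id)
        (auto simp: coboundary_map_eq_alternating_faces tuples_def)
    then show ?thesis
      by (simp add: coboundary_map_eq_alternating_faces alternating_faces_twice)
  qed (simp add: coboundary_map_eq_alternating_faces eval_nat_numeral)
  ultimately show ?thesis
    by (auto simp: cocycles_def cochains_def coboundary_map_eq_alternating_faces)
qed

lemma group_cocycle_group:
  assumes "\<And>g. g \<in> carrier G \<Longrightarrow> Modules.additive (act g)"
  shows "group (cocycle_group G act q)"
proof (rule groupI)
  let ?Z = "cocycle_group G act q"
  show "f \<otimes>\<^bsub>?Z\<^esub> h \<in> carrier ?Z" if "f \<in> carrier ?Z" "h \<in> carrier ?Z" for f h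
    using that assms
    by (auto simp: cocycle_group_def cocycles_def cochains_def fun_eq_iff Modules.additive.add
        coboundary_map_eq_alternating_faces alternating_faces_add split: if_splits)
  show zero: "\<one>\<^bsub>?Z\<^esub> \<in> carrier ?Z"
    using assms
    by (auto simp: cocycle_group_def cocycles_def cochains_def fun_eq_iff Modules.additive.zero
        coboundary_map_eq_alternating_faces alternating_faces_zero)
  show "\<exists>h\<in>carrier ?Z. h \<otimes>\<^bsub>?Z\<^esub> f = \<one>\<^bsub>?Z\<^esub>" if "f \<in> carrier ?Z" for f
  proof
    show "(\<lambda>xs. - f xs) \<in> carrier ?Z"
      using that assms
      by (auto simp: cocycle_group_def cocycles_def cochains_def fun_eq_iff Modules.additive.minus
          coboundary_map_eq_alternating_faces alternating_faces_uminus split: if_splits)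
  qed (simp add: cocycle_group_def)
qed (auto simp: cocycle_group_def algebra_simps)

lemma (in group) trivial_group_Mod_carrier: "trivial_group (G Mod carrier G)"
proof -
  have N: "carrier G \<lhd> G"
    by (simp add: normal_inv_iff subgroup_self)
  show ?thesis
    unfolding trivial_group_def
    using normal.factorgroup_is_group[OF N] subgroup_self
    by (auto simp: FactGroup_def RCOSETS_def coset_join2)
qed

text \<open>
  If \<open>z\<close> acts as \<open>c\<close>, the prism homotopy gives \<open>(c - 1) f = d (prism f)\<close> for a cocycle \<open>f\<close>. In degree
  0 the prism of \<open>f\<close> lives on the empty list, where it is 0, and the identity reads \<open>(c - 1) f = 0\<close>.
\<close>

theorem (in monoid) cohomology_vanishes_if_central_scalar:
  fixes smul :: "'k::field \<Rightarrow> 'v::ab_group_add \<Rightarrow> 'v"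
  assumes vs: "vector_space smul"
    and act: "\<And>g. g \<in> carrier G \<Longrightarrow> Vector_Spaces.linear smul smul (act g)"
    and z: "z \<in> carrier G" "\<And>g. g \<in> carrier G \<Longrightarrow> z \<otimes> g = g \<otimes> z"
    and scalar: "\<And>v. act z v = smul c v" "c \<noteq> 1"
  shows "trivial_group (group_cohomology G act q)"
proof -
  interpret vector_space smul by (rule vs)
  have act_additive: "Modules.additive (act g)" if "g \<in> carrier G" for g
    using act[OF that] by (simp add: Modules.additive_def Vector_Spaces.linear_iff)
  have smul_additive: "Modules.additive (smul r)" for r
    by (simp add: Modules.additive_def scale_right_distrib)
  let ?m = "\<lambda>x. z \<otimes> x"
  define r where "r = inverse (c - 1)"
  have key: "alternating_faces (\<lambda>ys. smul r (prism ?m f ys)) xs = f xs"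
    if f: "f \<in> cocycles G act q" and xs: "xs \<in> tuples G (q + 1)" for f xs
  proof -
    have "prism ?m (alternating_faces f) (map (\<lambda>x. x) xs) = prism ?m (\<lambda>_. 0) xs"
    proof (rule prism_natural[where S = "carrier G" and a = "\<lambda>v. v"])
      fix ys assume "set ys \<subseteq> carrier G" "length ys = Suc (length xs)"
      then have "ys \<in> tuples G (q + 2)"
        using xs by (simp add: tuples_def)
      then show "alternating_faces f (map (\<lambda>x. x) ys) = 0"
        using f coboundary_map_eq_alternating_faces[of G q f ys] by (simp add: cocycles_def)
    qed (use xs z(1) in \<open>auto simp: tuples_def additive_id\<close>)
    moreover have "prism ?m (\<lambda>_. 0) xs = (0::'v)"
      by (induction xs) auto
    ultimately have "alternating_faces (prism ?m f) xs = f (map ?m xs) - f xs"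
      using prism_homotopy[of ?m f xs] by simp
    also have "f (map ?m xs) = smul c (f xs)"
      using f xs z(1) scalar by (simp add: cocycles_def cochains_def)
    finally have "alternating_faces (prism ?m f) xs = smul (c - 1) (f xs)"
      by (simp add: scale_left_diff_distrib)
    moreover have "alternating_faces (\<lambda>ys. smul r (prism ?m f ys)) (map (\<lambda>x. x) xs)
        = smul r (alternating_faces (prism ?m f) xs)"
      by (rule alternating_faces_natural[where S = UNIV]) (auto simp: smul_additive)
    ultimately show ?thesis
      using scalar(2) by (simp add: r_def)
  qed
  have "cocycles G act q = coboundaries G act q"
  proof (cases q)
    case 0
    have "f = (\<lambda>_. 0)" if f: "f \<in> cocycles G act q" for f
    proof
      fix xs
      show "f xs = 0"
      proof (cases "xs \<in> tuples G (q + 1)")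
        case True
        then obtain x where "xs = [x]"
          using 0 by (auto simp: tuples_def length_Suc_conv)
        then show ?thesis
          using key[OF f True] by simp
      qed (use f in \<open>simp add: cocycles_def cochains_def\<close>)
    qed
    moreover have "(\<lambda>_. 0) \<in> cocycles G act q"
      using monoid.one_closed[OF group.is_monoid[OF group_cocycle_group[OF act_additive]]]
      by (simp add: cocycle_group_def)
    ultimately have "cocycles G act q = {\<lambda>_. 0}"
      by blast
    then show ?thesis
      using 0 by (simp add: coboundaries_def)
  next
    case (Suc p)
    have "f \<in> coboundary_map G p ` cochains G act p" if f: "f \<in> cocycles G act q" for f
    proof
      \<comment> \<open>The prism only has the values of a cochain on tuples, so it is cut off elsewhere.\<close>
      define h where "h = (\<lambda>ys. if ys \<in> tuples G (p + 1) then smul r (prism ?m f ys) else 0)"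
      show "h \<in> cochains G act p"
      proof -
        have "h (map (\<lambda>x. g \<otimes> x) ys) = act g (h ys)"
          if g: "g \<in> carrier G" and ys: "ys \<in> tuples G (p + 1)" for g ys
        proof -
          have "prism ?m f (map (\<lambda>x. g \<otimes> x) ys) = act g (prism ?m f ys)"
          proof (rule prism_natural[where S = "carrier G"])
            show "z \<otimes> (g \<otimes> x) = g \<otimes> (z \<otimes> x)" if "x \<in> carrier G" for x
              using that g z by (metis m_assoc)
          qed (use f g ys z(1) Suc act_additive in \<open>auto simp: cocycles_def cochains_def tuples_def\<close>)
          then show ?thesis
            using map_mult_tuples[OF g ys] ys act[OF g]
            by (simp add: h_def Vector_Spaces.linear_iff)
        qed
        then show ?thesis
          by (auto simp: cochains_def h_def)
      qed
      show "f = coboundary_map G p h"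
      proof
        fix xs
        show "f xs = coboundary_map G p h xs"
        proof (cases "xs \<in> tuples G (q + 1)")
          case True
          have "alternating_faces h (map (\<lambda>x. x) xs) = alternating_faces (\<lambda>ys. smul r (prism ?m f ys)) xs"
            using True Suc
            by (intro alternating_faces_natural[where S = "carrier G" and a = "\<lambda>v. v"] additive_id)
              (auto simp: h_def tuples_def)
          then show ?thesis
            using key[OF f True] True Suc by (simp add: coboundary_map_eq_alternating_faces)
        qed (use f Suc in \<open>simp add: cocycles_def cochains_def coboundary_map_eq_alternating_faces\<close>)
      qed
    qed
    then show ?thesis
      using coboundary_map_in_cocycles[OF act_additive] unfolding Suc coboundaries_def by auto
  qed
  then show ?thesis
    using group.trivial_group_Mod_carrier[OF group_cocycle_group[of G act q, OF act_additive]]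
    by (simp add: group_cohomology_def cocycle_group_def)
qed

section \<open>Scalar matrices\<close>

lemma mat_commutes:
  fixes A :: "'a::comm_semiring_1 ^ 'n ^ 'n"
  shows "mat c ** A = A ** mat c"
  by (simp add: matrix_matrix_mult_def mat_def vec_eq_iff mult_delta_left mult_delta_right mult.commute)

lemma mat_mult_mat:
  fixes c d :: "'a::semiring_1"
  shows "mat c ** mat d = (mat (c * d) :: 'a ^ 'n ^ 'n)"
  by (simp add: matrix_matrix_mult_def mat_def vec_eq_iff mult_delta_left)

lemma det_mat:
  fixes c :: "'a::comm_ring_1"
  shows "det (mat c :: 'a ^ 'n ^ 'n) = c ^ CARD('n)"
  by (subst det_diagonal) (simp_all add: mat_def)

lemma map_matrix_of_int_mat: "map_matrix of_int (mat c) = mat (of_int c)"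
  by (simp add: vec_eq_iff mat_def)

lemma map_matrix_of_int_mult:
  "map_matrix of_int (A ** B) = map_matrix of_int A ** map_matrix of_int B"
  by (simp add: vec_eq_iff matrix_matrix_mult_def)

lemma det_map_matrix_of_int: "det (map_matrix of_int A) = of_int (det A)"
  by (simp add: det_def)

lemma monoid_GL: "monoid (GL :: ('a::comm_ring_1 ^ 'n ^ 'n) monoid)"
  by unfold_locales (auto simp: GL_def matrix_mul_assoc invertible_mult invertible_def[of "mat 1"])

lemma monoid_SL: "monoid (SL :: ('a::comm_ring_1 ^ 'n ^ 'n) monoid)"
  by unfold_locales (auto simp: SL_def matrix_mul_assoc det_mul)

lemma map_matrix_in_GL:
  assumes "A \<in> carrier (GL :: (int ^ 'n ^ 'n) monoid)"
  shows "map_matrix of_int A \<in> carrier (GL :: ('a::comm_ring_1 ^ 'n ^ 'n) monoid)"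
proof -
  obtain B where "A ** B = mat 1" "B ** A = mat 1"
    using assms by (auto simp: GL_def invertible_def)
  then have "map_matrix of_int A ** map_matrix of_int B = (mat 1 :: 'a ^ 'n ^ 'n)"
    "map_matrix of_int B ** map_matrix of_int A = (mat 1 :: 'a ^ 'n ^ 'n)"
    by (simp_all flip: map_matrix_of_int_mult add: map_matrix_of_int_mat)
  then show ?thesis
    by (auto simp: GL_def invertible_def)
qed

lemma map_matrix_in_SL:
  assumes "A \<in> carrier (SL :: (int ^ 'n ^ 'n) monoid)"
  shows "map_matrix of_int A \<in> carrier (SL :: ('a::comm_ring_1 ^ 'n ^ 'n) monoid)"
  using assms by (simp add: SL_def det_map_matrix_of_int)

text \<open>
  Schur's argument: as a scalar matrix is central, the vectors on which it acts by a given scalar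
  form a subrepresentation, and for the scalar prescribed by the weight this subrepresentation
  contains the highest weight vector.
\<close>

lemma scalar_matrix_acts_by_highest_weight:
  fixes \<rho> :: "rat ^ 'n::{finite,linorder} ^ 'n::{finite,linorder} \<Rightarrow> 'v::ab_group_add \<Rightarrow> 'v"
  assumes hw: "highest_weight_module G \<mu> smul \<rho>"
    and mult: "mult G = (**)"
    and c: "mat c \<in> carrier G"
  shows "\<rho> (mat c) v = smul (\<Prod>i\<in>UNIV. c powi \<mu> i) v"
proof -
  let ?s = "\<Prod>i\<in>UNIV. c powi \<mu> i"
  have lin: "Vector_Spaces.linear smul smul (\<rho> g)" if "g \<in> carrier G" for g
    using hw that by (simp add: highest_weight_module_def algebraic_representation_def)
  have comp: "\<rho> (g ** h) = \<rho> g \<circ> \<rho> h" if "g \<in> carrier G" "h \<in> carrier G" for g h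
    using hw that mult by (simp add: highest_weight_module_def algebraic_representation_def)
  interpret c: Vector_Spaces.linear smul smul "\<rho> (mat c)"
    by (rule lin[OF c])
  define W where "W = {v. \<rho> (mat c) v = smul ?s v}"
  have "module.subspace smul W"
    by (auto simp: W_def c.vs1.subspace_def c.add c.scale c.vs1.scale_right_distrib c.vs1.scale_left_commute)
  moreover have "\<rho> g ` W \<subseteq> W" if g: "g \<in> carrier G" for g
  proof -
    have "\<rho> (mat c) (\<rho> g v) = smul ?s (\<rho> g v)" if "v \<in> W" for v
    proof -
      have "\<rho> (mat c) (\<rho> g v) = \<rho> g (\<rho> (mat c) v)"
        using comp[OF c g] comp[OF g c] by (metis comp_apply mat_commutes)
      also have "\<dots> = smul ?s (\<rho> g v)"
        using that lin[OF g] by (simp add: W_def Vector_Spaces.linear_iff)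
      finally show ?thesis .
    qed
    then show ?thesis
      by (auto simp: W_def)
  qed
  ultimately have "W = {0} \<or> W = UNIV"
    using hw by (auto simp: highest_weight_module_def irreducible_representation_def)
  moreover obtain v0 where "v0 \<noteq> 0" "\<rho> (mat c) v0 = smul ?s v0"
    using hw c by (auto simp: highest_weight_module_def has_highest_weight_def mat_def)
  ultimately have "W = UNIV"
    by (auto simp: W_def)
  then show ?thesis
    by (auto simp: W_def)
qed

lemma prod_minus_one_powi:
  "(\<Prod>i\<in>A. (- 1 :: 'a::field) powi \<mu> i) = (- 1) powi (\<Sum>i\<in>A. \<mu> i)"
  by (induction A rule: infinite_finite_induct) (auto simp: power_int_add)

text \<open>
  The indices are enumerated by \<open>sum_4\<close> as \<open>1, 2, 3, 4\<close>, whereas the weights and the order on the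
  index type use the representatives \<open>0, 1, 2, 3\<close>.
\<close>

lemma four_eq_zero_type_4: "(4 :: 4) = 0"
  by simp

lemma less_type_4: "0 < (1::4)" "0 < (2::4)" "0 < (3::4)" "1 < (2::4)" "1 < (3::4)" "2 < (3::4)"
  by (simp_all add: less_bit0_def bit0.Rep_0 bit0.Rep_1 bit0.Rep_numeral)

lemma sum_SL4_weight: "(\<Sum>j\<in>UNIV. SL4_weight l1 l2 l3 j) = int (l1 + 2 * l2 + 3 * l3)"
  using less_type_4 by (simp add: sum_4 four_eq_zero_type_4 SL4_weight_def fundamental_weight_def not_less_iff_gr_or_eq)

lemma sum_GL4_weight: "(\<Sum>j\<in>UNIV. GL4_weight l1 l2 l3 j) = int (l1 + 2 * l2 + 3 * l3)"
  using less_type_4 by (simp add: sum_4 four_eq_zero_type_4 GL4_weight_def)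

section \<open>Vanishing for weights of odd parity\<close>

theorem proposition13:
  fixes l1 l2 l3 q \<epsilon> :: nat
    and smulM :: "rat \<Rightarrow> 'm::ab_group_add \<Rightarrow> 'm" and \<rho> :: "rat ^ 4 ^ 4 \<Rightarrow> 'm \<Rightarrow> 'm"
    and smulN :: "rat \<Rightarrow> 'n::ab_group_add \<Rightarrow> 'n" and \<sigma> :: "rat ^ 4 ^ 4 \<Rightarrow> 'n \<Rightarrow> 'n"
  assumes "(l1 + l3) mod 2 = 1"
    and "\<epsilon> \<in> {0, 1}"
  shows "(highest_weight_module SL (SL4_weight l1 l2 l3) smulM \<rho> \<longrightarrow>
           trivial_group (group_cohomology (SL :: (int ^ 4 ^ 4) monoid) (restrict_to_int \<rho>) q)) \<and>
         (highest_weight_module GL (GL4_weight l1 l2 l3) smulN \<sigma> \<longrightarrow>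
           trivial_group (group_cohomology (GL :: (int ^ 4 ^ 4) monoid)
             (restrict_to_int (det_twist \<epsilon> smulN \<sigma>)) q))"
proof (intro conjI impI)
  have "odd (l1 + 2 * l2 + 3 * l3)"
    using assms(1) by presburger
  then have "(- 1 :: rat) powi int (l1 + 2 * l2 + 3 * l3) = - 1"
    by (simp only: power_int_of_nat) simp
  then have sign_SL: "(\<Prod>i\<in>UNIV. (- 1 :: rat) powi SL4_weight l1 l2 l3 i) = - 1"
    and sign_GL: "(\<Prod>i\<in>UNIV. (- 1 :: rat) powi GL4_weight l1 l2 l3 i) = - 1"
    by (simp_all only: prod_minus_one_powi sum_SL4_weight sum_GL4_weight)
  have minus_one_SL: "mat (- 1) \<in> carrier (SL :: ('a::comm_ring_1 ^ 4 ^ 4) monoid)"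
    by (simp add: SL_def det_mat)
  have minus_one_GL: "mat (- 1) \<in> carrier (GL :: ('a::comm_ring_1 ^ 4 ^ 4) monoid)"
  proof -
    have "mat (- 1) ** mat (- 1) = (mat 1 :: 'a ^ 4 ^ 4)"
      by (simp add: mat_mult_mat)
    then show ?thesis
      by (auto simp: GL_def invertible_def)
  qed
  {
    assume M: "highest_weight_module SL (SL4_weight l1 l2 l3) smulM \<rho>"
    then have lin: "Vector_Spaces.linear smulM smulM (\<rho> g)" if "g \<in> carrier SL" for g
      using that by (simp add: highest_weight_module_def algebraic_representation_def)
    have "\<rho> (mat (- 1)) v = smulM (- 1) v" for v
      using scalar_matrix_acts_by_highest_weight[OF M _ minus_one_SL]
      by (simp add: SL_def sign_SL)
    then have scalar: "restrict_to_int \<rho> (mat (- 1)) v = smulM (- 1) v" for v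
      by (simp add: restrict_to_int_def map_matrix_of_int_mat)
    show "trivial_group (group_cohomology (SL :: (int ^ 4 ^ 4) monoid) (restrict_to_int \<rho>) q)"
    proof (rule monoid.cohomology_vanishes_if_central_scalar
        [where z = "mat (- 1)" and c = "- 1" and smul = smulM, OF monoid_SL])
      show "vector_space smulM"
        using lin[OF minus_one_SL] by (simp add: Vector_Spaces.linear_iff)
      show "mat (- 1) \<otimes>\<^bsub>SL\<^esub> g = g \<otimes>\<^bsub>SL\<^esub> mat (- 1)" for g :: "int ^ 4 ^ 4"
        by (simp add: SL_def) (rule mat_commutes)
    qed (simp_all add: scalar minus_one_SL, simp add: lin restrict_to_int_def map_matrix_in_SL)
  }
  {
    assume N: "highest_weight_module GL (GL4_weight l1 l2 l3) smulN \<sigma>"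
    then have lin: "Vector_Spaces.linear smulN smulN (\<sigma> g)" if "g \<in> carrier GL" for g
      using that by (simp add: highest_weight_module_def algebraic_representation_def)
    then interpret vector_space smulN
      using minus_one_GL by (auto simp: Vector_Spaces.linear_iff)
    have lin_twist: "Vector_Spaces.linear smulN smulN (det_twist \<epsilon> smulN \<sigma> g)" if "g \<in> carrier GL" for g
      using lin[OF that] by (auto simp: Vector_Spaces.linear_iff det_twist_def scale_right_distrib mult.commute)
    have "\<sigma> (mat (- 1)) v = smulN (- 1) v" for v
      using scalar_matrix_acts_by_highest_weight[OF N _ minus_one_GL]
      by (simp add: GL_def sign_GL)
    then have scalar: "restrict_to_int (det_twist \<epsilon> smulN \<sigma>) (mat (- 1)) v = smulN (- 1) v" for v
      by (simp add: restrict_to_int_def map_matrix_of_int_mat det_twist_def det_mat)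
    show "trivial_group (group_cohomology (GL :: (int ^ 4 ^ 4) monoid)
             (restrict_to_int (det_twist \<epsilon> smulN \<sigma>)) q)"
    proof (rule monoid.cohomology_vanishes_if_central_scalar
        [where z = "mat (- 1)" and c = "- 1" and smul = smulN, OF monoid_GL])
      show "vector_space smulN"
        by (rule vector_space_axioms)
      show "mat (- 1) \<otimes>\<^bsub>GL\<^esub> g = g \<otimes>\<^bsub>GL\<^esub> mat (- 1)" for g :: "int ^ 4 ^ 4"
        by (simp add: GL_def) (rule mat_commutes)
    qed (simp_all add: scalar minus_one_GL, simp add: lin_twist restrict_to_int_def map_matrix_in_GL)
  }
qed

end
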